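(* Suppose that $X,Y$ are two metric trees, $A \subset X$ is a set that spans $X$, and $B \subset Y$ is a set that spans $Y$. Then \[ d_{\mathrm{GH}}(X,Y) \le d_{\mathrm{GH}}(A,B). \]
   Context: The distance of two points $x,x'$ in a metric space is written $|xx'|$; subsets carry the induced metric. A metric space $X$ is called geodesic if for every pair of points $x,x' \in X$ there is a geodesic segment $xx' \subset X$ connecting them, i.e., the image of an isometric embedding of the interval $[0,|xx'|]$ into $X$ that sends $0$ to $x$ and $|xx'|$ to $x'$. A metric tree is a geodesic metric space $X$ such that for any triple $(x,y,z)$ of points in $X$ and any geodesic segments $xy,xz,yz$ connecting them, $xy \subset xz \cup yz$. (No completeness is assumed.) A subset $A$ of a metric space $X$ spans $X$ if, for every pair $(x,x') \in X \times X$, \[ |xx'| = \sup_{a \in A} \bigl( |xa| - |x'a| \bigr). \] The Hausdorff distance $d^Z_{\mathrm{H}}(X',Y')$ of two subsets $X',Y'$ of a metric space $(Z,d^Z)$ is the infimum of all $\varrho > 0$ such that $X'$ is contained in the open $\varrho$-neighborhood of $Y'$ and vice versa. The Gromov–Hausdorff distance $d_{\mathrm{GH}}(X,Y) \in [0,\infty]$ of two metric spaces $X,Y$ is the infimum of all $\varrho > 0$ for which there exist a metric space $(Z,d^Z)$ and isometric copies $X',Y' \subset Z$ of $X$ and $Y$, respectively, such that $d^Z_{\mathrm{H}}(X',Y') < \varrho$. *)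

theory Defs
  imports "HOL-Analysis.Analysis"
begin

text \<open>Metric spaces are elements of \<^typ>\<open>'a metric\<close>: a carrier set with a metric, so that a
  subset with its induced metric is a \<^const>\<open>submetric\<close>. The carrier may be empty.\<close>

definition isometric_embedding :: "'a metric \<Rightarrow> 'b metric \<Rightarrow> ('a \<Rightarrow> 'b) \<Rightarrow> bool" where
  "isometric_embedding X Y f \<longleftrightarrow>
     f \<in> mspace X \<rightarrow> mspace Y \<and>
     (\<forall>x\<in>mspace X. \<forall>x'\<in>mspace X. mdist Y (f x) (f x') = mdist X x x')"

definition geodesic_segment :: "'a metric \<Rightarrow> 'a \<Rightarrow> 'a \<Rightarrow> 'a set \<Rightarrow> bool" where
  "geodesic_segment X x x' S \<longleftrightarrow>
     (\<exists>c. isometric_embedding (submetric euclidean_metric {0..mdist X x x'}) X c \<and>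
          c 0 = x \<and> c (mdist X x x') = x' \<and> S = c ` {0..mdist X x x'})"

definition geodesic_space :: "'a metric \<Rightarrow> bool" where
  "geodesic_space X \<longleftrightarrow> (\<forall>x\<in>mspace X. \<forall>x'\<in>mspace X. \<exists>S. geodesic_segment X x x' S)"

definition metric_tree :: "'a metric \<Rightarrow> bool" where
  "metric_tree X \<longleftrightarrow>
     geodesic_space X \<and>
     (\<forall>x\<in>mspace X. \<forall>y\<in>mspace X. \<forall>z\<in>mspace X. \<forall>Sxy Sxz Syz.
        geodesic_segment X x y Sxy \<and> geodesic_segment X x z Sxz \<and> geodesic_segment X y z Syz
        \<longrightarrow> Sxy \<subseteq> Sxz \<union> Syz)"

text \<open>The supremum is taken in \<^typ>\<open>ereal\<close>, where the empty set has supremum \<open>-\<infinity>\<close>;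
  hence the empty set spans only the empty space.\<close>

definition spans :: "'a set \<Rightarrow> 'a metric \<Rightarrow> bool" where
  "spans A X \<longleftrightarrow>
     A \<subseteq> mspace X \<and>
     (\<forall>x\<in>mspace X. \<forall>x'\<in>mspace X.
        ereal (mdist X x x') = (SUP a\<in>A. ereal (mdist X x a - mdist X x' a)))"

definition hausdorff_distance :: "'a metric \<Rightarrow> 'a set \<Rightarrow> 'a set \<Rightarrow> ennreal" where
  "hausdorff_distance Z S T =
     Inf {ennreal r |r. r > 0 \<and> S \<subseteq> (\<Union>t\<in>T. mball_of Z t r) \<and> T \<subseteq> (\<Union>s\<in>S. mball_of Z s r)}"

definition gh_close :: "'c itself \<Rightarrow> 'a metric \<Rightarrow> 'b metric \<Rightarrow> real \<Rightarrow> bool" where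
  "gh_close _ X Y r \<longleftrightarrow>
     (\<exists>(Z::'c metric) f g. isometric_embedding X Z f \<and> isometric_embedding Y Z g \<and>
        hausdorff_distance Z (f ` mspace X) (g ` mspace Y) < ennreal r)"

text \<open>The ambient space ranges over all metric spaces carried by subsets of \<^typ>\<open>'a + 'b\<close>. This
  is no restriction (lemma \<open>gh_close_imp_gh_close_sum\<close>): an ambient space may be
  cut down to the union of the two copies, which embeds in the sum type.\<close>

definition gh_distance :: "'a metric \<Rightarrow> 'b metric \<Rightarrow> ennreal" where
  "gh_distance X Y = Inf {ennreal r |r. r > 0 \<and> gh_close TYPE('a + 'b) X Y r}"

lemma gh_close_imp_gh_close_sum:
  fixes X :: "'a metric" and Y :: "'b metric"
  assumes "gh_close TYPE('c) X Y r"
  shows "gh_close TYPE('a + 'b) X Y r"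
proof -
  obtain Z :: "'c metric" and f g where
    f: "isometric_embedding X Z f" and g: "isometric_embedding Y Z g" and
    lt: "hausdorff_distance Z (f ` mspace X) (g ` mspace Y) < ennreal r"
    using assms by (auto simp: gh_close_def)
  define k where "k = case_sum f g"
  define h where "h z = (if z \<in> f ` mspace X then Inl (inv_into (mspace X) f z)
                         else Inr (inv_into (mspace Y) g z))" for z
  define U where "U = f ` mspace X \<union> g ` mspace Y"
  have kh: "k (h z) = z" if "z \<in> U" for z
    using that by (auto simp: U_def k_def h_def f_inv_into_f)
  have UZ: "U \<subseteq> mspace Z"
    using f g by (auto simp: U_def isometric_embedding_def)
  define D where "D a b = mdist Z (k a) (k b)" for a b
  have M: "Metric_space (h ` U) D"
    using UZ by unfold_locales (auto simp: D_def kh subset_iff mdist_commute intro!: mdist_triangle)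
  define W where "W = metric (h ` U, D)"
  have W: "mspace W = h ` U" "mdist W = D"
    using M by (simp_all add: W_def Metric_space.mspace_metric Metric_space.mdist_metric)
  have hf: "isometric_embedding X W (h \<circ> f)" and hg: "isometric_embedding Y W (h \<circ> g)"
    using f g kh by (auto simp: isometric_embedding_def W D_def U_def)
  have ball: "h u \<in> mball_of W (h v) s \<longleftrightarrow> u \<in> mball_of Z v s" if "u \<in> U" "v \<in> U" for u v s
    using that UZ by (auto simp: in_mball_of W D_def kh)
  have nbhd: "h ` S \<subseteq> (\<Union>t\<in>h ` T. mball_of W t s) \<longleftrightarrow> S \<subseteq> (\<Union>t\<in>T. mball_of Z t s)"
    if "S \<subseteq> U" "T \<subseteq> U" for S T s
  proof -
    have "h u \<in> (\<Union>t\<in>h ` T. mball_of W t s) \<longleftrightarrow> u \<in> (\<Union>t\<in>T. mball_of Z t s)" if "u \<in> U" for u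
      unfolding UN_iff bex_simps using ball that \<open>T \<subseteq> U\<close> by blast
    then show ?thesis
      using \<open>S \<subseteq> U\<close> by (simp only: image_subset_iff subset_iff) blast
  qed
  have "hausdorff_distance W (h ` S) (h ` T) = hausdorff_distance Z S T"
    if "S \<subseteq> U" "T \<subseteq> U" for S T
    using that nbhd by (simp add: hausdorff_distance_def)
  then have "hausdorff_distance W ((h \<circ> f) ` mspace X) ((h \<circ> g) ` mspace Y) < ennreal r"
    using lt unfolding image_comp [symmetric] by (metis U_def Un_upper1 Un_upper2)
  then show ?thesis
    using hf hg unfolding gh_close_def by blast
qed

end

theory Submission
  imports Defs
begin

text \<open>
  If \<open>A\<close> and \<open>B\<close> sit in a common metric space at Hausdorff distance less than \<open>\<rho>\<close>, then the pairs
  of points at distance less than \<open>\<rho>\<close> form a relation between \<open>A\<close> and \<open>B\<close> that distorts distances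
  by at most \<open>2 * \<rho>\<close>. Conversely, a relation \<open>R\<close> between \<open>X\<close> and \<open>Y\<close> with distortion at most
  \<open>2 * \<rho>\<close> yields a metric on the disjoint union in which related points have distance \<open>\<rho>\<close>; if the
  domain and the range of \<open>R\<close> are dense, the Hausdorff distance of the two copies is at most \<open>\<rho>\<close>.
  It therefore suffices to enlarge the given relation, with the same bound \<open>\<epsilon> = 2 * \<rho>\<close> on the
  distortion, until its domain and range are dense.

  Take a maximal enlargement \<open>R\<close> by Zorn's lemma. The key fact (\<open>extend_rough_isometry\<close>) is that
  if \<open>x\<close> lies between two points of the domain of \<open>R\<close>, some pair \<open>(x, y)\<close> can be added to \<open>R\<close>
  without raising the bound on the distortion. By maximality and symmetry, the domain and the range
  of \<open>R\<close> then contain all segments between their points. Every point of a tree is arbitrarily close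
  to a segment with end points in a given spanning set (\<open>spans_near_segment\<close>), which gives density.

  For the key fact, suppose first that some \<open>(a, a')\<close> and \<open>(b, b')\<close> in \<open>R\<close> have \<open>x\<close> between \<open>a\<close>
  and \<open>b\<close> and \<open>|ab| \<le> |a'b'|\<close>. Then suitable positions on \<open>a'b'\<close> satisfy all upper bounds
  \<open>|yc'| \<le> |xc| + \<epsilon>\<close> automatically, and the lower bounds \<open>|xc| - \<epsilon> \<le> |yc'|\<close> are the problem: each
  rules out an open interval of positions (\<open>extend_expanding\<close>). If there are no such pairs, \<open>R\<close>
  expands no segment through \<open>x\<close>; then the lower bounds are automatic in a suitable range, and each
  upper bound leaves an interval, so that a one-dimensional Helly argument applies
  (\<open>extend_contracting\<close>). In both cases \<open>y\<close> is a point of the compact segment \<open>a'b'\<close>, whence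
  the argument works in incomplete trees. Of the tree structure, it uses only the four point
  inequality and the existence of points at prescribed positions between two given points.
\<close>

lemma mdist_self: "x \<in> mspace X \<Longrightarrow> mdist X x x = 0"
  by simp

section \<open>The four point inequality in metric trees\<close>

lemma tree_segment:
  assumes "metric_tree X" "x \<in> mspace X" "y \<in> mspace X"
  obtains c where "c ` {0..mdist X x y} \<subseteq> mspace X" "geodesic_segment X x y (c ` {0..mdist X x y})"
    "\<And>s t. s \<in> {0..mdist X x y} \<Longrightarrow> t \<in> {0..mdist X x y} \<Longrightarrow> mdist X (c s) (c t) = \<bar>s - t\<bar>"
    "c 0 = x" "c (mdist X x y) = y"
proof -
  obtain S where S: "geodesic_segment X x y S"
    using assms unfolding metric_tree_def geodesic_space_def by blast
  then obtain c where c: "isometric_embedding (submetric euclidean_metric {0..mdist X x y}) X c"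
    "c 0 = x" "c (mdist X x y) = y" "S = c ` {0..mdist X x y}"
    unfolding geodesic_segment_def by blast
  show thesis
    by (rule that[of c]) (use c S in \<open>auto simp: isometric_embedding_def mdist_submetric dist_real_def\<close>)
qed

lemma segment_between:
  assumes "geodesic_segment X x y S" "p \<in> S" "x \<in> mspace X" "y \<in> mspace X"
  shows "p \<in> mspace X" "mdist X x p + mdist X p y = mdist X x y"
proof -
  obtain c where c: "isometric_embedding (submetric euclidean_metric {0..mdist X x y}) X c"
    "c 0 = x" "c (mdist X x y) = y" "S = c ` {0..mdist X x y}"
    using assms unfolding geodesic_segment_def by blast
  then obtain t where t: "t \<in> {0..mdist X x y}" "p = c t"
    using assms by blast
  show "p \<in> mspace X"
    using c t by (auto simp: isometric_embedding_def)
  have "mdist X (c u) (c v) = \<bar>u - v\<bar>" if "u \<in> {0..mdist X x y}" "v \<in> {0..mdist X x y}" for u v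
    using c(1) that by (auto simp: isometric_embedding_def mdist_submetric dist_real_def)
  from this[of 0 t] this[of t "mdist X x y"] t show "mdist X x p + mdist X p y = mdist X x y"
    by (auto simp: c(2,3))
qed

lemma tree_point_at:
  assumes "metric_tree X" "x \<in> mspace X" "y \<in> mspace X" "0 \<le> t" "t \<le> mdist X x y"
  obtains p where "p \<in> mspace X" "mdist X x p = t" "mdist X p y = mdist X x y - t"
proof -
  obtain c where c: "c ` {0..mdist X x y} \<subseteq> mspace X"
    "\<And>s t. s \<in> {0..mdist X x y} \<Longrightarrow> t \<in> {0..mdist X x y} \<Longrightarrow> mdist X (c s) (c t) = \<bar>s - t\<bar>"
    "c 0 = x" "c (mdist X x y) = y"
    using tree_segment[OF assms(1-3)] by metis
  show thesis
  proof (rule that[of "c t"])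
    show "c t \<in> mspace X" using c(1) assms by auto
    show "mdist X x (c t) = t" using c(2)[of 0 t] c(3) assms by auto
    show "mdist X (c t) y = mdist X x y - t" using c(2)[of t "mdist X x y"] c(4) assms by auto
  qed
qed

text \<open>The segment from \<open>x\<close> to \<open>y\<close> is covered by the points lying between \<open>x\<close> and \<open>z\<close> and those
  lying between \<open>y\<close> and \<open>z\<close>. Both parts are closed and nonempty, so they meet, by connectedness.
  The segment \<open>S\<close> is kept in the conclusion because thinness of triangles, which is to be applied
  to \<open>m\<close> again, speaks of segments.\<close>

lemma tree_median:
  assumes X: "metric_tree X" and x: "x \<in> mspace X" and y: "y \<in> mspace X" and z: "z \<in> mspace X"
  obtains m S where "geodesic_segment X x y S" "m \<in> S"
    "mdist X x m + mdist X m z = mdist X x z" "mdist X y m + mdist X m z = mdist X y z"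
proof -
  define L where "L = mdist X x y"
  obtain c where c: "c ` {0..L} \<subseteq> mspace X" "geodesic_segment X x y (c ` {0..L})"
    "\<And>s t. s \<in> {0..L} \<Longrightarrow> t \<in> {0..L} \<Longrightarrow> mdist X (c s) (c t) = \<bar>s - t\<bar>"
    "c 0 = x" "c L = y"
    using tree_segment[OF X x y] unfolding L_def by metis
  have L0: "0 \<le> L" by (simp add: L_def)
  obtain Sxz Syz where S: "geodesic_segment X x z Sxz" "geodesic_segment X y z Syz"
    using X x y z by (metis metric_tree_def geodesic_space_def)
  define P where "P = {t \<in> {0..L}. mdist X (c t) z + t = mdist X x z}"
  define Q where "Q = {t \<in> {0..L}. mdist X (c t) z - t = mdist X y z - L}"
  have cov: "{0..L} \<subseteq> P \<union> Q"
  proof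
    fix t assume t: "t \<in> {0..L}"
    then have "c t \<in> Sxz \<union> Syz"
      using X x y z c(2) S unfolding metric_tree_def by blast
    then have "mdist X x (c t) + mdist X (c t) z = mdist X x z \<or>
        mdist X y (c t) + mdist X (c t) z = mdist X y z"
      using segment_between S x y z by (metis Un_iff)
    moreover have "mdist X x (c t) = t" "mdist X y (c t) = L - t"
      using c(3)[of 0 t] c(3)[of L t] c(4,5) t L0 by auto
    ultimately show "t \<in> P \<union> Q" using t by (auto simp: P_def Q_def)
  qed
  have "1-lipschitz_on {0..L} (\<lambda>t. mdist X (c t) z)"
  proof (rule lipschitz_onI)
    fix s t assume st: "s \<in> {0..L}" "t \<in> {0..L}"
    then have "mdist X (c s) (c t) = \<bar>s - t\<bar>" "c s \<in> mspace X" "c t \<in> mspace X"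
      using c by auto
    then show "dist (mdist X (c s) z) (mdist X (c t) z) \<le> 1 * dist s t"
      using mdist_triangle[of "c s" X "c t" z] mdist_triangle[of "c t" X "c s" z] z
        mdist_commute[of X "c s" "c t"] by (auto simp: dist_real_def)
  qed simp
  then have cont: "continuous_on {0..L} (\<lambda>t. mdist X (c t) z)"
    by (rule lipschitz_on_continuous_on)
  have "closed P" "closed Q"
    unfolding P_def Q_def
    by (intro continuous_closed_preimage_constant continuous_intros cont closed_atLeastAtMost)+
  moreover have "0 \<in> P" "L \<in> Q"
    using L0 c(4,5) by (auto simp: P_def Q_def)
  ultimately have "P \<inter> Q \<noteq> {}"
    using connected_closedD[OF connected_Icc[of 0 L] _ cov] L0
    by (metis Int_iff atLeastAtMost_iff empty_iff inf_bot_left order_refl)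
  then obtain t where t: "t \<in> P" "t \<in> Q" by blast
  then have tL: "t \<in> {0..L}" by (simp add: P_def)
  have d: "mdist X x (c t) = t" "mdist X y (c t) = L - t"
    using c(3)[of 0 t] c(3)[of L t] c(4,5) tL L0 by auto
  show thesis
  proof (rule that[OF c(2)])
    show "c t \<in> c ` {0..L}" using tL by (rule imageI)
    show "mdist X x (c t) + mdist X (c t) z = mdist X x z"
      "mdist X y (c t) + mdist X (c t) z = mdist X y z"
      using t d by (simp_all add: P_def Q_def)
  qed
qed

text \<open>The median \<open>m\<close> of \<open>x\<close>, \<open>y\<close>, \<open>z\<close> lies on a segment from \<open>w\<close> to \<open>x\<close> or to \<open>y\<close>. In the
  first case \<open>|xw| + |yz| = |xm| + |mw| + |ym| + |mz|\<close>, which bounds the left-hand side; the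
  second case is symmetric.\<close>

lemma tree_four_point:
  assumes X: "metric_tree X"
    and x: "x \<in> mspace X" and y: "y \<in> mspace X" and z: "z \<in> mspace X" and w: "w \<in> mspace X"
  shows "mdist X x y + mdist X z w \<le> max (mdist X x z + mdist X y w) (mdist X x w + mdist X y z)"
proof -
  obtain m S where m: "geodesic_segment X x y S" "m \<in> S"
    "mdist X x m + mdist X m z = mdist X x z" "mdist X y m + mdist X m z = mdist X y z"
    using tree_median[OF X x y z] .
  obtain Sxw Syw where S: "geodesic_segment X x w Sxw" "geodesic_segment X y w Syw"
    using X x y w by (metis metric_tree_def geodesic_space_def)
  have "m \<in> Sxw \<union> Syw"
    using X x y w m S unfolding metric_tree_def by blast
  then have "mdist X x m + mdist X m w = mdist X x w \<or> mdist X y m + mdist X m w = mdist X y w"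
    using segment_between S x y w by (metis Un_iff)
  moreover have "m \<in> mspace X" "mdist X x m + mdist X m y = mdist X x y"
    using segment_between[OF m(1,2) x y] by auto
  moreover have "mdist X z w \<le> mdist X z m + mdist X m w"
    using z w \<open>m \<in> mspace X\<close> by (simp add: mdist_triangle)
  ultimately show ?thesis
    using m mdist_commute[of X y m] mdist_commute[of X z m] by auto
qed

section \<open>Extending rough isometries\<close>

definition rough_isometry :: "real \<Rightarrow> 'a metric \<Rightarrow> 'b metric \<Rightarrow> ('a \<times> 'b) set \<Rightarrow> bool" where
  "rough_isometry \<epsilon> X Y R \<longleftrightarrow>
     R \<subseteq> mspace X \<times> mspace Y \<and>
     (\<forall>(x, y)\<in>R. \<forall>(x', y')\<in>R. \<bar>mdist X x x' - mdist Y y y'\<bar> \<le> \<epsilon>)"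

lemma rough_isometryD:
  assumes "rough_isometry \<epsilon> X Y R" "(x, y) \<in> R"
  shows "x \<in> mspace X" "y \<in> mspace Y"
    and "(x', y') \<in> R \<Longrightarrow> \<bar>mdist X x x' - mdist Y y y'\<bar> \<le> \<epsilon>"
  using assms unfolding rough_isometry_def by blast+

lemma rough_isometry_converse: "rough_isometry \<epsilon> X Y R \<Longrightarrow> rough_isometry \<epsilon> Y X (R\<inverse>)"
  unfolding rough_isometry_def by (fastforce simp: abs_minus_commute)

text \<open>In a tree, the path from \<open>c\<close> to a point \<open>x\<close> of a segment continues through \<open>x\<close> to at least one
  of the two end points. Hence the distances from \<open>c\<close> to the end points determine the distance
  to \<open>x\<close>.\<close>

lemma tree_dist_via_segment:
  assumes X: "metric_tree X" and "a \<in> mspace X" "b \<in> mspace X" "x \<in> mspace X" "c \<in> mspace X"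
    and "mdist X a x + mdist X x b = mdist X a b"
  shows "mdist X x c = max (mdist X a c - mdist X a x) (mdist X b c - mdist X x b)"
proof -
  have "mdist X x c + mdist X a b \<le> max (mdist X x a + mdist X c b) (mdist X x b + mdist X c a)"
    using tree_four_point[OF X] assms by blast
  moreover have "mdist X a c \<le> mdist X a x + mdist X x c" "mdist X b c \<le> mdist X b x + mdist X x c"
    using assms by (auto intro: mdist_triangle)
  ultimately show ?thesis
    using mdist_commute[of X a x] mdist_commute[of X b x] mdist_commute[of X b c]
      mdist_commute[of X a c] assms(6) by linarith
qed

text \<open>Write \<open>s = |ax|\<close>, \<open>L = |ab|\<close>, \<open>L' = |a'b'|\<close>, and let \<open>t = |a'y|\<close> be the position of \<open>y\<close> on
  \<open>a'b'\<close>. All upper bounds hold for \<open>s \<le> t \<le> s + L' - L\<close>. The lower bound for \<open>(c, c')\<close> fails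
  exactly on the open interval from \<open>\<alpha> c c'\<close> to \<open>\<beta> c c'\<close>. If \<open>x\<close> is between \<open>a\<close> and \<open>c\<close>, this
  interval starts at or after \<open>s\<close>; if \<open>x\<close> is between \<open>b\<close> and \<open>c\<close>, it ends at or before
  \<open>s + L' - L\<close>. Put \<open>t\<close> at the supremum of the right ends of the intervals of the second kind,
  or at \<open>s\<close> if that is larger. Only an interval purely of the first kind can still contain \<open>t\<close>,
  and it would overlap one of the second kind; the four point inequality in \<open>Y\<close> excludes this.\<close>

lemma extend_expanding:
  assumes X: "metric_tree X" and Y: "metric_tree Y" and R: "rough_isometry \<epsilon> X Y R"
    and a: "(a, a') \<in> R" and b: "(b, b') \<in> R" and x: "x \<in> mspace X"
    and bet: "mdist X a x + mdist X x b = mdist X a b"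
    and exp: "mdist X a b \<le> mdist Y a' b'"
  obtains y where "y \<in> mspace Y" "\<And>c c'. (c, c') \<in> R \<Longrightarrow> \<bar>mdist X x c - mdist Y y c'\<bar> \<le> \<epsilon>"
proof -
  define s L L' where "s = mdist X a x" and "L = mdist X a b" and "L' = mdist Y a' b'"
  note RD = rough_isometryD[OF R]
  have L: "mdist X x b = L - s" "0 \<le> s" "s \<le> L" "L \<le> L'" "L' \<le> L + \<epsilon>"
    using bet exp RD(3)[OF a b] mdist_nonneg[of X x b] mdist_nonneg[of X a x]
    unfolding s_def L_def L'_def by linarith+
  note mem = RD(1)[OF a] RD(1)[OF b] RD(2)[OF a] RD(2)[OF b]
  have dx: "mdist X a c - s \<le> mdist X x c" "mdist X b c - (L - s) \<le> mdist X x c"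
    "mdist X x c = mdist X a c - s \<or> mdist X x c = mdist X b c - (L - s)"
    if "(c, c') \<in> R" for c c'
    using tree_dist_via_segment[OF X mem(1,2) x RD(1)[OF that] bet] L(1) unfolding s_def
    by linarith+
  have close: "mdist X a c \<le> mdist Y a' c' + \<epsilon>" "mdist Y a' c' \<le> mdist X a c + \<epsilon>"
    "mdist X b c \<le> mdist Y b' c' + \<epsilon>" "mdist Y b' c' \<le> mdist X b c + \<epsilon>"
    if "(c, c') \<in> R" for c c'
    using RD(3)[OF a that] RD(3)[OF b that] by linarith+
  define \<alpha> where "\<alpha> c c' = mdist Y a' c' - mdist X x c + \<epsilon>" for c c'
  define \<beta> where "\<beta> c c' = mdist X x c - \<epsilon> + L' - mdist Y b' c'" for c c'
  define T where "T = insert s {\<beta> c c' | c c'. (c, c') \<in> R \<and> \<alpha> c c' < \<beta> c c' \<and>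
    mdist X x c = mdist X b c - (L - s)}"
  have T: "t \<le> s + L' - L" if "t \<in> T" for t
  proof -
    have "\<beta> c c' \<le> s + L' - L" if "(c, c') \<in> R" "mdist X x c = mdist X b c - (L - s)" for c c'
      using close(3)[OF that(1)] that(2) unfolding \<beta>_def by linarith
    then show ?thesis using \<open>t \<in> T\<close> L(4) by (auto simp: T_def)
  qed
  then have bdd: "bdd_above T" by (meson bdd_above.I)
  define t where "t = Sup T"
  have sT: "s \<in> T" by (simp add: T_def)
  have t: "s \<le> t" "t \<le> s + L' - L"
    unfolding t_def using cSup_upper[OF sT bdd] cSup_least[of T] T sT by blast+
  have good: "t \<le> \<alpha> c c' \<or> \<beta> c c' \<le> t" if c: "(c, c') \<in> R" for c c'
  proof (cases "mdist X x c = mdist X b c - (L - s)")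
    case True
    then have "\<beta> c c' \<in> T" if "\<alpha> c c' < \<beta> c c'"
      using c that unfolding T_def by blast
    then show ?thesis
      using t cSup_upper[OF _ bdd] unfolding t_def by fastforce
  next
    case False
    show ?thesis
    proof (rule ccontr)
      assume "\<not> ?thesis"
      then have t': "\<alpha> c c' < t" "t < \<beta> c c'" by auto
      have xa: "mdist X x c = mdist X a c - s" "mdist X b c < mdist X x c + L - s"
        using dx[OF c] False by linarith+
      have "s \<le> \<alpha> c c'"
        using close[OF c] xa by (simp add: \<alpha>_def)
      then obtain e e' where e: "(e, e') \<in> R" "\<alpha> e e' < \<beta> e e'"
        "mdist X x e = mdist X b e - (L - s)" "\<alpha> c c' < \<beta> e e'"
        using t' less_cSupD[of T "\<alpha> c c'"] sT unfolding t_def T_def by fastforce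
      \<comment> \<open>The branch of \<open>c\<close> at \<open>x\<close> contains \<open>b\<close>, but \<open>e\<close> is not on it, so \<open>x\<close> lies between
        \<open>c\<close> and \<open>e\<close>.\<close>
      have ce: "mdist X x c + mdist X x e \<le> mdist X c e"
      proof -
        have "mdist X e b + mdist X x c \<le> max (mdist X e x + mdist X b c) (mdist X e c + mdist X b x)"
          using tree_four_point[OF X] RD(1)[OF c] RD(1)[OF e(1)] x mem by blast
        then show ?thesis
          using xa e(3) L(1) mdist_commute[of X e b] mdist_commute[of X e x]
            mdist_commute[of X e c] mdist_commute[of X b x] by linarith
      qed
      have "mdist Y c' e' + mdist Y a' b' \<le>
          max (mdist Y c' a' + mdist Y e' b') (mdist Y c' b' + mdist Y e' a')"
        using tree_four_point[OF Y] RD(2)[OF c] RD(2)[OF e(1)] mem by blast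
      then have "mdist Y c' e' + L' \<le>
          max (mdist Y a' c' + mdist Y b' e') (mdist Y b' c' + mdist Y a' e')"
        unfolding L'_def by (metis mdist_commute)
      moreover have "mdist X c e - \<epsilon> \<le> mdist Y c' e'"
        using RD(3)[OF c e(1)] by linarith
      \<comment> \<open>Since \<open>\<alpha> c c' < \<beta> e e'\<close>, the maximum above is its second entry. Adding the resulting
        inequality to the lower bounds for \<open>|a'c'|\<close> and \<open>|b'e'|\<close> contradicts the sum of
        \<open>\<alpha> c c' < \<beta> c c'\<close> and \<open>\<alpha> e e' < \<beta> e e'\<close>, because \<open>L' \<le> L + \<epsilon>\<close>.\<close>
      ultimately show False
        using ce e(2,3,4) t' close[OF c] close[OF e(1)] L xa unfolding \<alpha>_def \<beta>_def by linarith
    qed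
  qed
  have "0 \<le> t" "t \<le> mdist Y a' b'" using t L unfolding L'_def by linarith+
  then obtain y where y: "y \<in> mspace Y" "mdist Y a' y = t" "mdist Y y b' = L' - t"
    unfolding L'_def by (rule tree_point_at[OF Y mem(3,4)])
  show thesis
  proof (rule that[OF y(1)])
    fix c c' assume c: "(c, c') \<in> R"
    have "mdist Y y c' = max (mdist Y a' c' - t) (mdist Y b' c' - (L' - t))"
      using tree_dist_via_segment[OF Y mem(3,4) y(1) RD(2)[OF c]] y unfolding L'_def by simp
    moreover have "mdist Y a' c' - t \<le> mdist X x c + \<epsilon>"
      "mdist Y b' c' - (L' - t) \<le> mdist X x c + \<epsilon>"
      using close[OF c] t dx[OF c] by linarith+
    moreover have "mdist X x c - \<epsilon> \<le> mdist Y a' c' - t \<or> mdist X x c - \<epsilon> \<le> mdist Y b' c' - (L' - t)"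
      using good[OF c] unfolding \<alpha>_def \<beta>_def by linarith
    ultimately show "\<bar>mdist X x c - mdist Y y c'\<bar> \<le> \<epsilon>"
      by linarith
  qed
qed

text \<open>With the same notation, now \<open>L' \<le> L\<close>, and all lower bounds hold for \<open>s + L' - L \<le> t \<le> s\<close>. The
  upper bound for \<open>(c, c')\<close> holds on the interval from \<open>l c c'\<close> to \<open>u c c'\<close>. Any two of these
  intervals meet, by the four point inequality in \<open>Y\<close>; the delicate case is that of two points whose
  paths to \<open>a'b'\<close> arrive at the same point. There it is not enough that \<open>R\<close> does not expand \<open>ab\<close>:
  the bound \<open>sum\<close> below also relies on this for a segment from \<open>c\<close> through \<open>x\<close> to \<open>a\<close> or \<open>b\<close>. This
  is why \<open>con\<close> is assumed for all segments through \<open>x\<close>.\<close>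

lemma extend_contracting:
  assumes X: "metric_tree X" and Y: "metric_tree Y" and R: "rough_isometry \<epsilon> X Y R"
    and a: "(a, a') \<in> R" and b: "(b, b') \<in> R" and x: "x \<in> mspace X"
    and bet: "mdist X a x + mdist X x b = mdist X a b"
    and con: "\<And>c c' e e'. (c, c') \<in> R \<Longrightarrow> (e, e') \<in> R \<Longrightarrow>
      mdist X c x + mdist X x e = mdist X c e \<Longrightarrow> mdist Y c' e' \<le> mdist X c e"
  obtains y where "y \<in> mspace Y" "\<And>c c'. (c, c') \<in> R \<Longrightarrow> \<bar>mdist X x c - mdist Y y c'\<bar> \<le> \<epsilon>"
proof -
  define s L L' where "s = mdist X a x" and "L = mdist X a b" and "L' = mdist Y a' b'"
  note RD = rough_isometryD[OF R]
  have L: "mdist X x b = L - s" "0 \<le> s" "s \<le> L" "L' \<le> L" "L \<le> L' + \<epsilon>" "0 \<le> L'"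
    using bet con[OF a b bet] RD(3)[OF a b] mdist_nonneg[of X x b] mdist_nonneg[of X a x]
      mdist_nonneg[of Y a' b']
    unfolding s_def L_def L'_def by linarith+
  have \<epsilon>: "0 \<le> \<epsilon>" using L by linarith
  note mem = RD(1)[OF a] RD(1)[OF b] RD(2)[OF a] RD(2)[OF b]
  have dx: "mdist X a c - s \<le> mdist X x c" "mdist X b c - (L - s) \<le> mdist X x c"
    "mdist X x c = mdist X a c - s \<or> mdist X x c = mdist X b c - (L - s)"
    if "(c, c') \<in> R" for c c'
    using tree_dist_via_segment[OF X mem(1,2) x RD(1)[OF that] bet] L(1) unfolding s_def
    by linarith+
  have close: "mdist X a c \<le> mdist Y a' c' + \<epsilon>" "mdist Y a' c' \<le> mdist X a c + \<epsilon>"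
    "mdist X b c \<le> mdist Y b' c' + \<epsilon>" "mdist Y b' c' \<le> mdist X b c + \<epsilon>"
    if "(c, c') \<in> R" for c c'
    using RD(3)[OF a that] RD(3)[OF b that] by linarith+
  define l where "l c c' = mdist Y a' c' - mdist X x c - \<epsilon>" for c c'
  define u where "u c c' = mdist X x c + \<epsilon> + L' - mdist Y b' c'" for c c'
  have sum: "mdist Y a' c' + mdist Y b' c' \<le> 2 * mdist X x c + L' + 2 * \<epsilon>" if c: "(c, c') \<in> R" for c c'
  proof -
    have "mdist X a x + mdist X x c = mdist X a c \<or> mdist X b x + mdist X x c = mdist X b c"
      using dx[OF c] L(1) mdist_commute[of X b x] unfolding s_def by linarith
    then have "mdist Y a' c' \<le> mdist X a c \<or> mdist Y b' c' \<le> mdist X b c"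
      using con[OF a c] con[OF b c] by blast
    then show ?thesis using close[OF c] dx[OF c] L by linarith
  qed
  \<comment> \<open>In the second case of the maximum, \<open>|a'c'| + |b'e'|\<close> is at most half the total of all four
    distances, which is bounded by \<open>sum\<close> for \<open>c\<close> and for \<open>e\<close>.\<close>
  have lu: "l c c' \<le> u e e'" if c: "(c, c') \<in> R" and e: "(e, e') \<in> R" for c c' e e'
  proof -
    have "mdist Y a' c' + mdist Y b' e' \<le>
        max (mdist Y a' b' + mdist Y c' e') (mdist Y a' e' + mdist Y c' b')"
      using tree_four_point[OF Y] RD(2)[OF c] RD(2)[OF e] mem by blast
    moreover have "mdist Y c' b' = mdist Y b' c'" by (rule mdist_commute)
    moreover have "mdist Y c' e' \<le> mdist X c e + \<epsilon>"
      using RD(3)[OF c e] by linarith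
    moreover have "mdist X c e \<le> mdist X x c + mdist X x e"
      using mdist_triangle[of c X x e] RD(1)[OF c] RD(1)[OF e] x mdist_commute[of X c x] by simp
    ultimately show ?thesis
      using sum[OF c] sum[OF e] \<epsilon> unfolding l_def u_def L'_def[symmetric] by linarith
  qed
  define T where "T = {max 0 (s + L' - L)} \<union> {l c c' | c c'. (c, c') \<in> R}"
  \<comment> \<open>Every left end is below every right end, including those of the intervals from \<open>0\<close> to \<open>L'\<close>
    and from \<open>s + L' - L\<close> to \<open>s\<close>; the supremum of the left ends is then a common point.\<close>
  have ub: "r \<le> s" "r \<le> L'" "(c, c') \<in> R \<Longrightarrow> r \<le> u c c'" if "r \<in> T" for r c c'
  proof -
    have *: "l c c' \<le> s" "0 \<le> u c c'" "s + L' - L \<le> u c c'" "l c c' \<le> L'"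
      if c: "(c, c') \<in> R" for c c'
    proof -
      have m: "c \<in> mspace X" "c' \<in> mspace Y" using RD[OF c] by auto
      show "l c c' \<le> s" "s + L' - L \<le> u c c'"
        using close[OF c] dx[OF c] L unfolding l_def u_def by linarith+
      have "mdist Y b' c' \<le> L' + mdist Y a' c'" "mdist Y a' c' \<le> L' + mdist Y b' c'"
        using mdist_triangle[of b' Y a' c'] mdist_triangle[of a' Y b' c'] mem m
        unfolding L'_def by (simp_all add: mdist_commute)
      then show "0 \<le> u c c'" "l c c' \<le> L'"
        using sum[OF c] unfolding l_def u_def by linarith+
    qed
    show "r \<le> s" using that * L by (auto simp: T_def)
    show "r \<le> L'" using that * L by (auto simp: T_def)
    show "(c, c') \<in> R \<Longrightarrow> r \<le> u c c'" using that lu * by (auto simp: T_def)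
  qed
  have bdd: "bdd_above T" using ub(1) by (meson bdd_above.I)
  define t where "t = Sup T"
  have lT: "max 0 (s + L' - L) \<in> T" "(c, c') \<in> R \<Longrightarrow> l c c' \<in> T" for c c'
    by (auto simp: T_def)
  have t: "0 \<le> t" "s + L' - L \<le> t" "t \<le> s" "t \<le> L'"
    unfolding t_def using cSup_upper[OF lT(1) bdd] cSup_least[of T] ub lT(1) by fastforce+
  have tc: "l c c' \<le> t" "t \<le> u c c'" if "(c, c') \<in> R" for c c'
    unfolding t_def using cSup_upper[OF lT(2) bdd] cSup_least[of T] ub lT(1) that by blast+
  have "0 \<le> t" "t \<le> mdist Y a' b'" using t L unfolding L'_def by linarith+
  then obtain y where y: "y \<in> mspace Y" "mdist Y a' y = t" "mdist Y y b' = L' - t"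
    unfolding L'_def by (rule tree_point_at[OF Y mem(3,4)])
  show thesis
  proof (rule that[OF y(1)])
    fix c c' assume c: "(c, c') \<in> R"
    have "mdist Y y c' = max (mdist Y a' c' - t) (mdist Y b' c' - (L' - t))"
      using tree_dist_via_segment[OF Y mem(3,4) y(1) RD(2)[OF c]] y unfolding L'_def by simp
    moreover have "mdist Y a' c' - t \<le> mdist X x c + \<epsilon>"
      "mdist Y b' c' - (L' - t) \<le> mdist X x c + \<epsilon>"
      using tc[OF c] unfolding l_def u_def by linarith+
    moreover have "mdist X x c - \<epsilon> \<le> mdist Y a' c' - t \<or> mdist X x c - \<epsilon> \<le> mdist Y b' c' - (L' - t)"
      using dx[OF c] close[OF c] t by linarith
    ultimately show "\<bar>mdist X x c - mdist Y y c'\<bar> \<le> \<epsilon>"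
      by linarith
  qed
qed

lemma extend_rough_isometry:
  assumes X: "metric_tree X" and Y: "metric_tree Y" and R: "rough_isometry \<epsilon> X Y R"
    and "a \<in> Domain R" and "b \<in> Domain R" and x: "x \<in> mspace X"
    and bet: "mdist X a x + mdist X x b = mdist X a b"
  obtains y where "rough_isometry \<epsilon> X Y (insert (x, y) R)"
proof -
  obtain a' b' where ab: "(a, a') \<in> R" "(b, b') \<in> R" using assms by blast
  have \<epsilon>: "0 \<le> \<epsilon>" using rough_isometryD(3)[OF R ab(1,1)] by linarith
  obtain y where y: "y \<in> mspace Y" "\<And>c c'. (c, c') \<in> R \<Longrightarrow> \<bar>mdist X x c - mdist Y y c'\<bar> \<le> \<epsilon>"
  proof (cases "\<exists>c c' e e'. (c, c') \<in> R \<and> (e, e') \<in> R \<and> mdist X c x + mdist X x e = mdist X c e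
      \<and> mdist X c e \<le> mdist Y c' e'")
    case True
    then show ?thesis using extend_expanding[OF X Y R _ _ x] that by metis
  next
    case False
    then show ?thesis using extend_contracting[OF X Y R ab x bet] that by (metis linear)
  qed
  have "rough_isometry \<epsilon> X Y (insert (x, y) R)"
    unfolding rough_isometry_def
  proof (intro conjI ballI; clarify?)
    show "p \<in> mspace X \<and> q \<in> mspace Y" if "(p, q) \<in> insert (x, y) R" for p q
      using that rough_isometryD(1,2)[OF R] x y(1) by blast
  next
    fix p p' q q' assume pq: "(p, p') \<in> insert (x, y) R" "(q, q') \<in> insert (x, y) R"
    have "\<bar>mdist X p x - mdist Y p' y\<bar> \<le> \<epsilon>" if "(p, p') \<in> R"
      using y(2)[OF that] by (simp add: mdist_commute)
    moreover have "\<bar>mdist X x x - mdist Y y y\<bar> \<le> \<epsilon>" using x y(1) \<epsilon> by (simp add: mdist_self)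
    ultimately show "\<bar>mdist X p q - mdist Y p' q'\<bar> \<le> \<epsilon>"
      using pq y(2) rough_isometryD(3)[OF R] by blast
  qed
  then show thesis by (rule that)
qed

lemma maximal_rough_isometry:
  assumes "rough_isometry \<epsilon> X Y R0"
  obtains R where "R0 \<subseteq> R" "rough_isometry \<epsilon> X Y R"
    "\<And>p. rough_isometry \<epsilon> X Y (insert p R) \<Longrightarrow> p \<in> R"
proof -
  define F where "F = {R. rough_isometry \<epsilon> X Y R \<and> R0 \<subseteq> R}"
  have "\<exists>M\<in>F. \<forall>N\<in>F. M \<subseteq> N \<longrightarrow> N = M"
  proof (rule subset_Zorn_nonempty)
    show "F \<noteq> {}" using assms by (auto simp: F_def)
  next
    fix C assume C: "C \<noteq> {}" "subset.chain F C"
    have "\<bar>mdist X x x' - mdist Y y y'\<bar> \<le> \<epsilon>"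
      if xy: "P \<in> C" "(x, y) \<in> P" "Q \<in> C" "(x', y') \<in> Q" for P Q x y x' y'
    proof -
      have "P \<subseteq> Q \<or> Q \<subseteq> P" using C xy by (auto simp: subset_chain_def)
      then obtain S where "S \<in> C" "(x, y) \<in> S" "(x', y') \<in> S" using xy by blast
      moreover have "rough_isometry \<epsilon> X Y S" using C \<open>S \<in> C\<close> by (auto simp: F_def subset_chain_def)
      ultimately show ?thesis by (meson rough_isometryD(3))
    qed
    moreover have "\<Union> C \<subseteq> mspace X \<times> mspace Y" "R0 \<subseteq> \<Union> C"
      using C unfolding F_def rough_isometry_def subset_chain_def by blast+
    ultimately show "\<Union> C \<in> F"
      unfolding F_def rough_isometry_def by blast
  qed
  then obtain R where "R \<in> F" "\<And>N. N \<in> F \<Longrightarrow> R \<subseteq> N \<Longrightarrow> N = R" by blast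
  then show thesis
    using that[of R] unfolding F_def by blast
qed

section \<open>Density of a maximal rough isometry\<close>

text \<open>Spanning, applied to the pair \<open>(a, x)\<close>, provides \<open>b\<close> with \<open>|ax| + |xb| < |ab| + \<delta>\<close>. In a
  tree, such an \<open>x\<close> is close to the segment from \<open>a\<close> to \<open>b\<close>. It need not lie on a segment of this
  kind: the set \<open>{0} \<union> {1/2<..<1}\<close> spans \<open>{0..1}\<close>, but \<open>1\<close> is on no segment between its points.\<close>

lemma spans_near_segment:
  assumes X: "metric_tree X" and A: "spans A X" and a: "a \<in> A" and x: "x \<in> mspace X" and "0 < \<delta>"
  obtains b p where "b \<in> A" "p \<in> mspace X" "mdist X a p + mdist X p b = mdist X a b" "mdist X x p < \<delta>"
proof -
  have AX: "A \<subseteq> mspace X" using A by (simp add: spans_def)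
  then have aX: "a \<in> mspace X" using a by blast
  have "ereal (mdist X a x) = (SUP b\<in>A. ereal (mdist X a b - mdist X x b))"
    using A aX x by (simp add: spans_def)
  moreover have "ereal (mdist X a x - \<delta>) < ereal (mdist X a x)" using \<open>0 < \<delta>\<close> by simp
  ultimately obtain b where b: "b \<in> A" "mdist X a x - \<delta> < mdist X a b - mdist X x b"
    by (metis (no_types, lifting) less_SUP_iff less_ereal.simps(1))
  then have bX: "b \<in> mspace X" using AX by blast
  define t where "t = min (mdist X a x) (mdist X a b)"
  have "0 \<le> t" "t \<le> mdist X a b" by (auto simp: t_def)
  then obtain p where p: "p \<in> mspace X" "mdist X a p = t" "mdist X p b = mdist X a b - t"
    using tree_point_at[OF X aX bX] by metis
  have "mdist X p x = max (mdist X a x - t) (mdist X b x - (mdist X a b - t))"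
    using tree_dist_via_segment[OF X aX bX p(1) x] p by simp
  then have "mdist X x p < \<delta>"
    using b mdist_commute[of X b x] mdist_commute[of X x p] mdist_nonneg[of X x b] \<open>0 < \<delta>\<close>
    unfolding t_def by linarith
  then show thesis using that b p by simp
qed

lemma maximal_domain_dense:
  assumes X: "metric_tree X" and Y: "metric_tree Y" and A: "spans A X"
    and R: "rough_isometry \<epsilon> X Y R" "A \<subseteq> Domain R"
    and max: "\<And>p. rough_isometry \<epsilon> X Y (insert p R) \<Longrightarrow> p \<in> R"
    and x: "x \<in> mspace X" and "0 < \<delta>"
  shows "\<exists>p\<in>Domain R. mdist X x p < \<delta>"
proof -
  have "A \<noteq> {}"
  proof
    assume "A = {}"
    then have "ereal (mdist X x x) = - \<infinity>"
      using A x by (auto simp: spans_def bot_ereal_def)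
    then show False by simp
  qed
  then obtain a where a: "a \<in> A" by blast
  obtain b p where bp: "b \<in> A" "p \<in> mspace X" "mdist X a p + mdist X p b = mdist X a b" "mdist X x p < \<delta>"
    using spans_near_segment[OF X A a x \<open>0 < \<delta>\<close>] .
  obtain y where "rough_isometry \<epsilon> X Y (insert (p, y) R)"
    using extend_rough_isometry[OF X Y R(1) _ _ bp(2,3)] a bp R by blast
  then show ?thesis using max bp by blast
qed

section \<open>Rough isometries and the Gromov-Hausdorff distance\<close>

lemma hausdorff_distance_le:
  assumes "0 < r"
    and "\<And>s. s \<in> S \<Longrightarrow> \<exists>t\<in>T. s \<in> mball_of Z t r"
    and "\<And>t. t \<in> T \<Longrightarrow> \<exists>s\<in>S. t \<in> mball_of Z s r"
  shows "hausdorff_distance Z S T \<le> ennreal r"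
  unfolding hausdorff_distance_def using assms by (intro Inf_lower) blast

text \<open>Each pair of \<open>R\<close> is thought of as an edge of length \<open>\<rho>\<close>; the value is the infimal length of
  the paths from \<open>x\<close> to \<open>y\<close> that cross one edge.\<close>

definition glue_dist :: "real \<Rightarrow> 'a metric \<Rightarrow> 'b metric \<Rightarrow> ('a \<times> 'b) set \<Rightarrow> 'a \<Rightarrow> 'b \<Rightarrow> real" where
  "glue_dist \<rho> X Y R x y = (INF (u, v)\<in>R. mdist X x u + \<rho> + mdist Y v y)"

lemma glue_dist_le:
  assumes "(u, v) \<in> R" "0 \<le> \<rho>"
  shows "glue_dist \<rho> X Y R x y \<le> mdist X x u + \<rho> + mdist Y v y"
  unfolding glue_dist_def
  by (rule cINF_lower2[OF _ assms(1)]) (auto intro!: bdd_belowI2[of _ 0] add_nonneg_nonneg simp: assms(2))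

fun sum_dist :: "real \<Rightarrow> 'a metric \<Rightarrow> 'b metric \<Rightarrow> ('a \<times> 'b) set \<Rightarrow> 'a + 'b \<Rightarrow> 'a + 'b \<Rightarrow> real" where
  "sum_dist \<rho> X Y R (Inl x) (Inl x') = mdist X x x'"
| "sum_dist \<rho> X Y R (Inr y) (Inr y') = mdist Y y y'"
| "sum_dist \<rho> X Y R (Inl x) (Inr y) = glue_dist \<rho> X Y R x y"
| "sum_dist \<rho> X Y R (Inr y) (Inl x) = glue_dist \<rho> X Y R x y"

text \<open>A path from \<open>X\<close> to \<open>Y\<close> and back uses two pairs of \<open>R\<close> and so pays \<open>2 * \<rho>\<close>. This is
  exactly the distortion allowed to \<open>R\<close>, so such a detour never shortens a distance in \<open>X\<close>.\<close>

lemma Metric_space_sum_dist: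
  assumes R: "rough_isometry (2 * \<rho>) X Y R" "R \<noteq> {}" and \<rho>: "0 < \<rho>"
  shows "Metric_space (mspace X <+> mspace Y) (sum_dist \<rho> X Y R)"
proof -
  let ?g = "glue_dist \<rho> X Y R"
  note RD = rough_isometryD[OF R(1)]
  have lower: "?g x y \<le> mdist X x u + \<rho> + mdist Y v y" if "(u, v) \<in> R" for x y u v
    using glue_dist_le[OF that] \<rho> by simp
  have greatest: "z \<le> ?g x y" if "\<And>u v. (u, v) \<in> R \<Longrightarrow> z \<le> mdist X x u + \<rho> + mdist Y v y" for x y z
    unfolding glue_dist_def using R(2) that by (intro cINF_greatest) auto
  have pos: "\<rho> \<le> ?g x y" for x y
    by (rule greatest) (simp add: add_nonneg_nonneg)
  have tX: "?g x y \<le> mdist X x x' + ?g x' y"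
    if "x \<in> mspace X" "x' \<in> mspace X" for x x' y
  proof -
    have "?g x y - mdist X x x' \<le> ?g x' y"
    proof (rule greatest)
      fix u v assume uv: "(u, v) \<in> R"
      show "?g x y - mdist X x x' \<le> mdist X x' u + \<rho> + mdist Y v y"
        using lower[OF uv, of x y] mdist_triangle[of x X x' u] that RD(1)[OF uv] by linarith
    qed
    then show ?thesis by linarith
  qed
  have tY: "?g x y \<le> ?g x y' + mdist Y y' y"
    if "y \<in> mspace Y" "y' \<in> mspace Y" for x y y'
  proof -
    have "?g x y - mdist Y y' y \<le> ?g x y'"
    proof (rule greatest)
      fix u v assume uv: "(u, v) \<in> R"
      show "?g x y - mdist Y y' y \<le> mdist X x u + \<rho> + mdist Y v y'"
        using lower[OF uv, of x y] mdist_triangle[of v Y y' y] that RD(2)[OF uv] by linarith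
    qed
    then show ?thesis by linarith
  qed
  have dX: "mdist X x x' \<le> ?g x y + ?g x' y"
    if m: "x \<in> mspace X" "x' \<in> mspace X" "y \<in> mspace Y" for x x' y
  proof -
    have "mdist X x x' - ?g x' y \<le> ?g x y"
    proof (rule greatest)
      fix u v assume uv: "(u, v) \<in> R"
      have "mdist X x x' - (mdist X x u + \<rho> + mdist Y v y) \<le> ?g x' y"
      proof (rule greatest)
        fix u' v' assume uv': "(u', v') \<in> R"
        show "mdist X x x' - (mdist X x u + \<rho> + mdist Y v y) \<le> mdist X x' u' + \<rho> + mdist Y v' y"
          using RD(3)[OF uv uv'] mdist_triangle[of x X u x'] mdist_triangle[of u X u' x']
            mdist_triangle[of v Y y v'] m RD(1,2)[OF uv] RD(1,2)[OF uv']
            mdist_commute[of X u' x'] mdist_commute[of Y v' y] by linarith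
      qed
      then show "mdist X x x' - ?g x' y \<le> mdist X x u + \<rho> + mdist Y v y" by linarith
    qed
    then show ?thesis by linarith
  qed
  have dY: "mdist Y y y' \<le> ?g x y + ?g x y'"
    if m: "x \<in> mspace X" "y \<in> mspace Y" "y' \<in> mspace Y" for x y y'
  proof -
    have "mdist Y y y' - ?g x y' \<le> ?g x y"
    proof (rule greatest)
      fix u v assume uv: "(u, v) \<in> R"
      have "mdist Y y y' - (mdist X x u + \<rho> + mdist Y v y) \<le> ?g x y'"
      proof (rule greatest)
        fix u' v' assume uv': "(u', v') \<in> R"
        show "mdist Y y y' - (mdist X x u + \<rho> + mdist Y v y) \<le> mdist X x u' + \<rho> + mdist Y v' y'"
          using RD(3)[OF uv uv'] mdist_triangle[of y Y v y'] mdist_triangle[of v Y v' y']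
            mdist_triangle[of u X x u'] m RD(1,2)[OF uv] RD(1,2)[OF uv']
            mdist_commute[of X u x] mdist_commute[of Y v y] by linarith
      qed
      then show "mdist Y y y' - ?g x y' \<le> mdist X x u + \<rho> + mdist Y v y" by linarith
    qed
    then show ?thesis by linarith
  qed
  have g0: "0 < ?g x y" for x y using pos[of x y] \<rho> by linarith
  show ?thesis
  proof
    show "0 \<le> sum_dist \<rho> X Y R p q" for p q
      using g0 by (cases p; cases q) (auto simp: less_imp_le)
    show "sum_dist \<rho> X Y R p q = sum_dist \<rho> X Y R q p" for p q
      by (cases p; cases q) (auto simp: mdist_commute)
    show "sum_dist \<rho> X Y R p q = 0 \<longleftrightarrow> p = q"
      if "p \<in> mspace X <+> mspace Y" "q \<in> mspace X <+> mspace Y" for p q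
      using that g0 by (auto simp: less_imp_neq[symmetric])
    have tX': "?g x' y \<le> ?g x y + mdist X x x'" if "x \<in> mspace X" "x' \<in> mspace X" for x x' y
      using tX[OF that(2,1)] by (simp add: mdist_commute add.commute)
    have tY': "?g x y \<le> mdist Y y y' + ?g x y'" if "y \<in> mspace Y" "y' \<in> mspace Y" for x y y'
      using tY[OF that] by (simp add: mdist_commute add.commute)
    show "sum_dist \<rho> X Y R p r \<le> sum_dist \<rho> X Y R p q + sum_dist \<rho> X Y R q r"
      if "p \<in> mspace X <+> mspace Y" "q \<in> mspace X <+> mspace Y" "r \<in> mspace X <+> mspace Y"
      for p q r
      using that by (auto simp: mdist_triangle tX tY tX' tY' dX dY)
  qed
qed

lemma gh_close_of_dense_rough_isometry:
  fixes X :: "'a metric" and Y :: "'b metric"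
  assumes R: "rough_isometry (2 * \<rho>) X Y R" and \<rho>: "0 < \<rho>" "\<rho> < r"
    and dom: "\<And>x \<delta>. x \<in> mspace X \<Longrightarrow> 0 < \<delta> \<Longrightarrow> \<exists>u\<in>Domain R. mdist X x u < \<delta>"
    and ran: "\<And>y \<delta>. y \<in> mspace Y \<Longrightarrow> 0 < \<delta> \<Longrightarrow> \<exists>v\<in>Range R. mdist Y y v < \<delta>"
  shows "gh_close TYPE('a + 'b) X Y r"
proof (cases "R = {}")
  case True
  then have e: "mspace X = {}" "mspace Y = {}"
    using dom[of _ 1] ran[of _ 1] by auto
  have "hausdorff_distance Z {} {} \<le> ennreal \<rho>" for Z :: "('a + 'b) metric"
    using \<rho> by (intro hausdorff_distance_le) auto
  also have "ennreal \<rho> < ennreal r" using \<rho> by (simp add: ennreal_lessI)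
  finally show ?thesis using e by (auto simp: gh_close_def isometric_embedding_def)
next
  case False
  define Z where "Z = metric (mspace X <+> mspace Y, sum_dist \<rho> X Y R)"
  have Z: "mspace Z = mspace X <+> mspace Y" "mdist Z = sum_dist \<rho> X Y R"
    using Metric_space_sum_dist[OF R False \<rho>(1)]
    by (simp_all add: Z_def Metric_space.mspace_metric Metric_space.mdist_metric)
  note RD = rough_isometryD[OF R]
  \<comment> \<open>The slack \<open>\<sigma> - \<rho>\<close> absorbs the distance of a point to the dense domain or range of \<open>R\<close>.\<close>
  obtain \<sigma> where \<sigma>: "\<rho> < \<sigma>" "\<sigma> < r" using \<rho>(2) dense by blast
  have "hausdorff_distance Z (Inl ` mspace X) (Inr ` mspace Y) \<le> ennreal \<sigma>"
  proof (rule hausdorff_distance_le)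
    show "0 < \<sigma>" using \<rho> \<sigma> by simp
  next
    fix p :: "'a + 'b" assume "p \<in> Inl ` mspace X"
    then obtain x where x: "p = Inl x" "x \<in> mspace X" by blast
    obtain u v where uv: "(u, v) \<in> R" "mdist X x u < \<sigma> - \<rho>"
      using dom[OF x(2), of "\<sigma> - \<rho>"] \<sigma> by auto
    have "glue_dist \<rho> X Y R x v < \<sigma>"
      using glue_dist_le[OF uv(1), of \<rho> X Y x v] \<rho>(1) uv(2) RD(2)[OF uv(1)] by (simp add: mdist_self)
    then show "\<exists>q\<in>Inr ` mspace Y. p \<in> mball_of Z q \<sigma>"
      using x RD(2)[OF uv(1)] by (auto simp: in_mball_of Z intro!: bexI[of _ v])
  next
    fix p :: "'a + 'b" assume "p \<in> Inr ` mspace Y"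
    then obtain y where y: "p = Inr y" "y \<in> mspace Y" by blast
    obtain u v where uv: "(u, v) \<in> R" "mdist Y y v < \<sigma> - \<rho>"
      using ran[OF y(2), of "\<sigma> - \<rho>"] \<sigma> by auto
    have "glue_dist \<rho> X Y R u y < \<sigma>"
      using glue_dist_le[OF uv(1), of \<rho> X Y u y] \<rho>(1) uv(2) RD(1)[OF uv(1)] by (simp add: mdist_self mdist_commute)
    then show "\<exists>q\<in>Inl ` mspace X. p \<in> mball_of Z q \<sigma>"
      using y RD(1)[OF uv(1)] by (auto simp: in_mball_of Z intro!: bexI[of _ u])
  qed
  also have "ennreal \<sigma> < ennreal r" using \<rho> \<sigma> by (simp add: ennreal_lessI)
  finally have "hausdorff_distance Z (Inl ` mspace X) (Inr ` mspace Y) < ennreal r" .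
  moreover have "isometric_embedding X Z Inl" "isometric_embedding Y Z Inr"
    by (auto simp: isometric_embedding_def Z)
  ultimately show ?thesis unfolding gh_close_def by blast
qed

lemma gh_close_imp_rough_isometry:
  assumes "gh_close TYPE('c) X Y r"
  obtains \<rho> R where "0 < \<rho>" "\<rho> < r" "rough_isometry (2 * \<rho>) X Y R"
    "Domain R = mspace X" "Range R = mspace Y"
proof -
  obtain Z :: "'c metric" and f g where
    f: "isometric_embedding X Z f" and g: "isometric_embedding Y Z g" and
    lt: "hausdorff_distance Z (f ` mspace X) (g ` mspace Y) < ennreal r"
    using assms by (auto simp: gh_close_def)
  obtain \<rho> where \<rho>: "0 < \<rho>" "ennreal \<rho> < ennreal r"
    and XY: "f ` mspace X \<subseteq> (\<Union>t\<in>g ` mspace Y. mball_of Z t \<rho>)"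
    and YX: "g ` mspace Y \<subseteq> (\<Union>s\<in>f ` mspace X. mball_of Z s \<rho>)"
    using lt unfolding hausdorff_distance_def Inf_less_iff by blast
  have fZ: "f x \<in> mspace Z" "mdist Z (f x) (f x') = mdist X x x'"
    if "x \<in> mspace X" "x' \<in> mspace X" for x x'
    using f that by (auto simp: isometric_embedding_def)
  have gZ: "g y \<in> mspace Z" "mdist Z (g y) (g y') = mdist Y y y'"
    if "y \<in> mspace Y" "y' \<in> mspace Y" for y y'
    using g that by (auto simp: isometric_embedding_def)
  define R where "R = {(x, y) \<in> mspace X \<times> mspace Y. mdist Z (f x) (g y) < \<rho>}"
  have "\<bar>mdist X x x' - mdist Y y y'\<bar> \<le> 2 * \<rho>" if "(x, y) \<in> R" "(x', y') \<in> R" for x y x' y'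
  proof -
    have m: "x \<in> mspace X" "x' \<in> mspace X" "y \<in> mspace Y" "y' \<in> mspace Y"
      and d: "mdist Z (f x) (g y) < \<rho>" "mdist Z (f x') (g y') < \<rho>"
      using that by (auto simp: R_def)
    have mZ: "f x \<in> mspace Z" "f x' \<in> mspace Z" "g y \<in> mspace Z" "g y' \<in> mspace Z"
      using fZ gZ m by auto
    show ?thesis
      using fZ(2)[OF m(1,2)] gZ(2)[OF m(3,4)] d
        mdist_triangle[of "f x" Z "g y" "f x'"] mdist_triangle[of "g y" Z "g y'" "f x'"]
        mdist_triangle[of "g y" Z "f x" "g y'"] mdist_triangle[of "f x" Z "f x'" "g y'"]
        mZ mdist_commute[of Z "f x" "g y"] mdist_commute[of Z "f x'" "g y'"] by linarith
  qed
  then have "rough_isometry (2 * \<rho>) X Y R"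
    unfolding rough_isometry_def by (auto simp: R_def)
  moreover have "Domain R = mspace X"
    using XY fZ(1) by (fastforce simp: R_def in_mball_of mdist_commute)
  moreover have "Range R = mspace Y"
    using YX gZ(1) by (fastforce simp: R_def in_mball_of)
  moreover have "\<rho> < r" using \<rho> by (simp add: ennreal_less_iff)
  ultimately show thesis using that \<rho>(1) by blast
qed

theorem theorem3p2:
  fixes X :: "'a metric" and Y :: "'b metric"
  assumes "metric_tree X" and "metric_tree Y"
    and "spans A X" and "spans B Y"
  shows "gh_distance X Y \<le> gh_distance (submetric X A) (submetric Y B)"
proof -
  have "gh_close TYPE('a + 'b) X Y r"
    if r: "gh_close TYPE('a + 'b) (submetric X A) (submetric Y B) r" for r
  proof -
    have AB: "A \<subseteq> mspace X" "B \<subseteq> mspace Y" using assms by (auto simp: spans_def)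
    then have sub: "mspace (submetric X A) = A" "mspace (submetric Y B) = B"
      by auto
    obtain \<rho> R0 where \<rho>: "0 < \<rho>" "\<rho> < r"
      and "rough_isometry (2 * \<rho>) (submetric X A) (submetric Y B) R0"
      and R0: "Domain R0 = A" "Range R0 = B"
      using gh_close_imp_rough_isometry[OF r] unfolding sub by metis
    then have "rough_isometry (2 * \<rho>) X Y R0"
      using AB unfolding rough_isometry_def by (auto simp: mdist_submetric)
    then obtain R where R: "R0 \<subseteq> R" "rough_isometry (2 * \<rho>) X Y R"
      and max: "\<And>p. rough_isometry (2 * \<rho>) X Y (insert p R) \<Longrightarrow> p \<in> R"
      using maximal_rough_isometry by metis
    have max': "p \<in> R\<inverse>" if "rough_isometry (2 * \<rho>) Y X (insert p (R\<inverse>))" for p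
    proof -
      have "(insert p (R\<inverse>))\<inverse> = insert (prod.swap p) R" by (cases p) auto
      then have "rough_isometry (2 * \<rho>) X Y (insert (prod.swap p) R)"
        using rough_isometry_converse[OF that] by simp
      then show ?thesis using max by (cases p) auto
    qed
    show ?thesis
    proof (rule gh_close_of_dense_rough_isometry[OF R(2) \<rho>])
      have "A \<subseteq> Domain R" "B \<subseteq> Domain (R\<inverse>)" using R(1) R0 by auto
      then show "\<exists>u\<in>Domain R. mdist X x u < \<delta>" if "x \<in> mspace X" "0 < \<delta>" for x \<delta>
        using maximal_domain_dense[OF assms(1,2,3) R(2) _ max that] by simp
      show "\<exists>v\<in>Range R. mdist Y y v < \<delta>" if "y \<in> mspace Y" "0 < \<delta>" for y \<delta>
        using maximal_domain_dense[OF assms(2,1,4) rough_isometry_converse[OF R(2)] _ max' that]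
          \<open>B \<subseteq> Domain (R\<inverse>)\<close> by simp
    qed
  qed
  then show ?thesis
    unfolding gh_distance_def by (intro Inf_superset_mono) blast
qed

end
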